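(* Let $p \in (0,1]$ and let $S_{wcs}$ be the (random) schedule output by Algorithm 3 with parameter $p$ on an instance of the Min-WCS problem, and let $S^*_{wc}$ and $S^*_{cs}$ be the schedules output by Algorithm 1 and Algorithm 2 on that instance. Then $$\frac{\mathbf{E}[wcs(S_{wcs})]}{wc(S^*_{wc}) + cs(S^*_{cs})} \leq \max\{1+\tfrac{1}{p},\, 1+3p\}.$$
   Context: Min-WCS problem. Input: a positive integer $n$ and job chains $\mathcal{C}_1,\dots,\mathcal{C}_n$, where $\mathcal{C}_i$ consists of $|\mathcal{C}_i|\geq 1$ jobs $J_i^1 \to \cdots \to J_i^{|\mathcal{C}_i|}$, each job $J_i^j$ having a non-negative weight $w_i^j$; $J_i^{|\mathcal{C}_i|}$ is the leaf job of $\mathcal{C}_i$. With $T=\sum_i |\mathcal{C}_i|$, a feasible schedule $S$ is a bijection from the set of all jobs to $\{1,\dots,T\}$ with $S(J_i^1)<\cdots<S(J_i^{|\mathcal{C}_i|})$ for all $i$. $wc(S)=\sum_{i,j} w_i^j S(J_i^j)$, $cs(S)=\sum_{i} S(J_i^{|\mathcal{C}_i|})^2$, $wcs(S)=wc(S)+cs(S)$. Algorithm 1: for the job $J_i^j$ let $\rho_i^j = \max_{j \leq k \leq |\mathcal{C}_i|} \frac{w_i^j+\cdots+w_i^k}{k-j+1}$. For $t=1,\dots,T$: among the first not-yet-scheduled job of each chain that still has unscheduled jobs, pick one with maximum $\rho_i^j$ (ties arbitrary) and give it completion time $t$. The output is $S^*_{wc}$. Algorithm 2: process the chains one after another, each chain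 entirely and contiguously in its chain order, in nondecreasing order of $|\mathcal{C}_i|$ (ties arbitrary), starting at time 0. The output is $S^*_{cs}$. Algorithm 3 with parameter $p\in[0,1]$: compute $S^*_{wc}$ and $S^*_{cs}$. Draw independent random variables $X_1,\dots,X_{T-1}$, each equal to 1 with probability $p$ and 0 otherwise. For each job $J$ set $S^{int}_{cs}(J) = S^*_{cs}(J) + \sum_{i=1}^{S^*_{cs}(J)-1} X_i$. For $k=1,\dots,T$, for the job $J$ with $S^*_{wc}(J)=k$, set $S^{int}_{wc}(J)$ to the $k$-th smallest positive integer not in the image of $S^{int}_{cs}$. For each job $J$ set $S'_{wcs}(J)=\min\{S^{int}_{cs}(J), S^{int}_{wc}(J)\}$. Finally $S_{wcs}(J)$ is the rank of $S'_{wcs}(J)$ in increasing order among the values $\{S'_{wcs}(J') : J' \text{ a job}\}$ (i.e. $S_{wcs}(J)=i$ if $J$ is the $i$-th completed job under $S'_{wcs}$). *)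

theory Defs
  imports "HOL-Library.Infinite_Set" "HOL-Probability.Product_PMF"
begin

text \<open>The job \<open>J_i^j\<close> is the pair \<open>(i, j)\<close>, with chains and positions numbered from 1.
  A schedule maps jobs to completion times; its values outside \<open>jobs I\<close> are irrelevant.\<close>

type_synonym job = "nat \<times> nat"

type_synonym schedule = "job \<Rightarrow> nat"

record wcs_instance =
  num_chains :: nat
  chain_len :: "nat \<Rightarrow> nat"
  job_weight :: "nat \<Rightarrow> nat \<Rightarrow> real"

definition jobs :: "wcs_instance \<Rightarrow> job set" where
  "jobs I = (SIGMA i:{1..num_chains I}. {1..chain_len I i})"

definition valid_instance :: "wcs_instance \<Rightarrow> bool" where
  "valid_instance I \<longleftrightarrow>
     1 \<le> num_chains I \<and>
     (\<forall>i\<in>{1..num_chains I}. 1 \<le> chain_len I i) \<and>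
     (\<forall>(i, j)\<in>jobs I. 0 \<le> job_weight I i j)"

definition num_jobs :: "wcs_instance \<Rightarrow> nat" where
  "num_jobs I = (\<Sum>i=1..num_chains I. chain_len I i)"

definition wc :: "wcs_instance \<Rightarrow> schedule \<Rightarrow> real" where
  "wc I S = (\<Sum>(i, j)\<in>jobs I. job_weight I i j * real (S (i, j)))"

definition cs :: "wcs_instance \<Rightarrow> schedule \<Rightarrow> real" where
  "cs I S = (\<Sum>i=1..num_chains I. (real (S (i, chain_len I i)))\<^sup>2)"

definition wcs :: "wcs_instance \<Rightarrow> schedule \<Rightarrow> real" where
  "wcs I S = wc I S + cs I S"

text \<open>The schedule \<open>S\<close> completes the jobs one per time unit in the order given by the list.\<close>

definition schedules_list :: "schedule \<Rightarrow> job list \<Rightarrow> bool" where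
  "schedules_list S Js \<longleftrightarrow> (\<forall>t<length Js. S (Js ! t) = t + 1)"

definition rho :: "wcs_instance \<Rightarrow> job \<Rightarrow> real" where
  "rho I = (\<lambda>(i, j). Max ((\<lambda>k. (\<Sum>l=j..k. job_weight I i l) / real (k - j + 1)) ` {j..chain_len I i}))"

text \<open>If \<open>A\<close> is the set of jobs scheduled so far, these are the first unscheduled jobs of all
  chains that are not yet exhausted.\<close>

definition available_jobs :: "wcs_instance \<Rightarrow> job set \<Rightarrow> job set" where
  "available_jobs I A = {(i, j) \<in> jobs I - A. \<forall>k<j. (i, k) \<notin> jobs I - A}"

inductive alg1_run :: "wcs_instance \<Rightarrow> job list \<Rightarrow> bool" for I where
  start: "alg1_run I []"
| step: "alg1_run I Js \<Longrightarrow> J \<in> available_jobs I (set Js) \<Longrightarrow>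
    (\<forall>J'\<in>available_jobs I (set Js). rho I J' \<le> rho I J) \<Longrightarrow> alg1_run I (Js @ [J])"

text \<open>Ties are broken arbitrarily in both of the following algorithms, so their outputs are
  described by relations.\<close>

definition alg1_output :: "wcs_instance \<Rightarrow> schedule \<Rightarrow> bool" where
  "alg1_output I S \<longleftrightarrow>
     (\<exists>Js. alg1_run I Js \<and> length Js = num_jobs I \<and> schedules_list S Js)"

definition alg2_output :: "wcs_instance \<Rightarrow> schedule \<Rightarrow> bool" where
  "alg2_output I S \<longleftrightarrow>
     (\<exists>order. distinct order \<and> set order = {1..num_chains I} \<and> sorted (map (chain_len I) order) \<and>
        schedules_list S (concat (map (\<lambda>i. map (Pair i) [1..<chain_len I i + 1]) order)))"

definition S_cs_int :: "schedule \<Rightarrow> (nat \<Rightarrow> bool) \<Rightarrow> schedule" where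
  "S_cs_int S_cs X J = S_cs J + (\<Sum>i=1..S_cs J - 1. of_bool (X i))"

text \<open>\<open>enumerate\<close> counts the elements of a set from 0, whence the shift by one.\<close>

definition S_wc_int :: "wcs_instance \<Rightarrow> schedule \<Rightarrow> schedule \<Rightarrow> (nat \<Rightarrow> bool) \<Rightarrow> schedule" where
  "S_wc_int I S_wc S_cs X J =
     enumerate {m. 0 < m \<and> m \<notin> S_cs_int S_cs X ` jobs I} (S_wc J - 1)"

definition S_wcs_pre :: "wcs_instance \<Rightarrow> schedule \<Rightarrow> schedule \<Rightarrow> (nat \<Rightarrow> bool) \<Rightarrow> schedule" where
  "S_wcs_pre I S_wc S_cs X J = min (S_cs_int S_cs X J) (S_wc_int I S_wc S_cs X J)"

definition S_wcs :: "wcs_instance \<Rightarrow> schedule \<Rightarrow> schedule \<Rightarrow> (nat \<Rightarrow> bool) \<Rightarrow> schedule" where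
  "S_wcs I S_wc S_cs X J =
     card {v \<in> S_wcs_pre I S_wc S_cs X ` jobs I. v \<le> S_wcs_pre I S_wc S_cs X J}"

text \<open>The distribution of the random output schedule of the randomised combination of the
  outputs of the first two algorithms.\<close>

definition alg3 :: "real \<Rightarrow> wcs_instance \<Rightarrow> schedule \<Rightarrow> schedule \<Rightarrow> schedule pmf" where
  "alg3 p I S_wc S_cs =
     map_pmf (S_wcs I S_wc S_cs) (Pi_pmf {1..num_jobs I - 1} False (\<lambda>_. bernoulli_pmf p))"

end

theory Submission
  imports Defs
begin

text \<open>Write \<open>N\<^sub>i = X\<^sub>1 + \<dots> + X\<^sub>i\<close>. Every job \<open>J\<close> satisfies \<open>S_wcs J \<le> S_cs_int J\<close> and
  \<open>S_wcs J \<le> S_wc_int J\<close>, so the two parts of the objective can be bounded separately.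
  With \<open>s = S_cs J\<close> and \<open>B = N\<^bsub>s-1\<^esub> \<le> s\<close> we have \<open>(s + B)\<^sup>2 \<le> s\<^sup>2 + 3 s B\<close>, whose
  expectation is at most \<open>(1 + 3 p) s\<^sup>2\<close>. With \<open>k = S_wc J\<close>, the \<open>k\<close>-th free slot is at most
  \<open>k + c\<close>, where \<open>c\<close> is the number of \<open>i < T\<close> with \<open>N\<^sub>i < k\<close>, that is, the time of the
  \<open>k\<close>-th success truncated at \<open>T\<close>. By Wald's argument \<open>p c - min N\<^bsub>T-1\<^esub> k\<close> has the
  expectation of \<open>p\<close> times the indicator of \<open>N\<^bsub>T-1\<^esub> < k\<close>, so \<open>c\<close> has expectation at most
  \<open>k / p\<close>.\<close>

section \<open>Partial sums of the coin flips\<close>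

definition successes :: "(nat \<Rightarrow> bool) \<Rightarrow> nat \<Rightarrow> nat" where
  "successes X n = (\<Sum>i=1..n. of_bool (X i))"

lemma successes_Suc: "successes X (Suc n) = successes X n + of_bool (X (Suc n))"
  by (simp add: successes_def)

lemma successes_mono: "m \<le> n \<Longrightarrow> successes X m \<le> successes X n"
  unfolding successes_def by (rule sum_mono2) auto

lemma successes_le: "successes X n \<le> n"
  by (induction n) (auto simp: successes_Suc, simp add: successes_def)

lemma successes_fun_upd: "n < m \<Longrightarrow> successes (X(m := b)) n = successes X n"
  unfolding successes_def by (rule sum.cong) auto

subsection \<open>Independent Bernoulli trials\<close>

text \<open>The length is a parameter so that expectations can be computed by induction on it; for
  \<open>n = num_jobs I - 1\<close> this is the sample space of \<open>alg3\<close>.\<close>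

definition trials :: "real \<Rightarrow> nat \<Rightarrow> (nat \<Rightarrow> bool) pmf" where
  "trials p n = Pi_pmf {1..n} False (\<lambda>_. bernoulli_pmf p)"

lemma finite_set_trials: "finite (set_pmf (trials p n))"
  unfolding trials_def
proof (rule finite_subset[OF set_Pi_pmf_subset])
  have "{f. \<forall>x. x \<notin> {1..n} \<longrightarrow> f x = False} = PiE_dflt {1..n} False (\<lambda>_. UNIV)"
    by (auto simp: PiE_dflt_def)
  then show "finite {f. \<forall>x. x \<notin> {1..n} \<longrightarrow> f x = False}"
    by (simp add: finite_PiE_dflt)
qed simp

lemma integrable_trials [simp]:
  fixes f :: "(nat \<Rightarrow> bool) \<Rightarrow> real"
  shows "integrable (measure_pmf (trials p n)) f"
  by (rule integrable_measure_pmf_finite) (rule finite_set_trials)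

text \<open>Conditions on the last trial, which is independent of the first
  \<open>n\<close>.\<close>

lemma expectation_trials_Suc:
  fixes f :: "(nat \<Rightarrow> bool) \<Rightarrow> real"
  assumes "0 \<le> p" "p \<le> 1"
  shows "measure_pmf.expectation (trials p (Suc n)) f =
    measure_pmf.expectation (trials p n)
      (\<lambda>X. p * f (X(Suc n := True)) + (1 - p) * f (X(Suc n := False)))"
proof -
  have "trials p (Suc n) =
      bernoulli_pmf p \<bind> (\<lambda>b. map_pmf (\<lambda>X. X(Suc n := b)) (trials p n))"
    by (simp add: trials_def atLeastAtMostSuc_conv Pi_pmf_insert' map_pmf_def)
  also have "measure_pmf.expectation \<dots> f =
      (\<Sum>b\<in>UNIV. pmf (bernoulli_pmf p) b *
        measure_pmf.expectation (trials p n) (\<lambda>X. f (X(Suc n := b))))"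
    by (subst pmf_expectation_bind[where A = UNIV]) (auto simp: finite_set_trials)
  also have "\<dots> = measure_pmf.expectation (trials p n)
      (\<lambda>X. p * f (X(Suc n := True)) + (1 - p) * f (X(Suc n := False)))"
    using assms by (simp add: UNIV_bool)
  finally show ?thesis .
qed

lemma expectation_successes:
  assumes "0 \<le> p" "p \<le> 1" "m \<le> n"
  shows "measure_pmf.expectation (trials p n) (\<lambda>X. real (successes X m)) = real m * p"
proof -
  have "measure_pmf.expectation (trials p n) (\<lambda>X. of_bool (X i) :: real) = p"
    if "i \<in> {1..m}" for i
  proof -
    have "measure_pmf.expectation (trials p n) (\<lambda>X. of_bool (X i) :: real) =
        measure_pmf.expectation (map_pmf (\<lambda>X. X i) (trials p n)) of_bool"
      by simp
    also have "map_pmf (\<lambda>X. X i) (trials p n) = bernoulli_pmf p"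
      using that assms unfolding trials_def by (subst Pi_pmf_component) auto
    finally show ?thesis
      using assms by simp
  qed
  then show ?thesis
    by (simp add: successes_def del: sum_of_bool_eq)
qed

lemma expectation_waiting_time:
  assumes "0 \<le> p" "p \<le> 1"
  shows "p * measure_pmf.expectation (trials p n)
      (\<lambda>X. \<Sum>i\<le>n. of_bool (successes X i < k)) \<le> real k"
proof -
  \<comment> \<open>Trial \<open>i + 1\<close> is counted iff fewer than \<open>k\<close> successes
    precede it, so this is the compensated success count, stopped at the \<open>k\<close>-th
    success.\<close>
  define \<Phi> where "\<Phi> = (\<lambda>n X. p * (\<Sum>i<n. of_bool (successes X i < k))
    - real (min (successes X n) k))"
  have martingale: "measure_pmf.expectation (trials p n) (\<Phi> n) = 0" for n
  proof (induction n)
    case 0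
    show ?case by (simp add: \<Phi>_def trials_def successes_def)
  next
    case (Suc n)
    have upd: "\<Phi> (Suc n) (X(Suc n := b)) = \<Phi> n X + (p - of_bool b) * of_bool (successes X n < k)"
      for X b
      by (simp add: \<Phi>_def successes_Suc successes_fun_upd algebra_simps min_def of_bool_def)
    \<comment> \<open>The increments \<open>p - 1\<close> and \<open>p\<close> average to zero under
      the weights \<open>p\<close> and \<open>1 - p\<close>.\<close>
    have "p * \<Phi> (Suc n) (X(Suc n := True)) + (1 - p) * \<Phi> (Suc n) (X(Suc n := False)) = \<Phi> n X"
      for X
      unfolding upd by (simp add: algebra_simps)
    then show ?case
      using Suc.IH assms by (simp add: expectation_trials_Suc)
  qed
  \<comment> \<open>The sum has one term more than in \<open>\<Phi> n\<close>. If that term is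
    nonzero, it is \<open>p \<le> 1\<close>, and the integer \<open>successes X n\<close> leaves a
    gap of at least 1 below \<open>k\<close>.\<close>
  have "p * (\<Sum>i\<le>n. of_bool (successes X i < k)) \<le> \<Phi> n X + real k" for X
  proof -
    have "p * of_bool (successes X n < k) + real (min (successes X n) k) \<le> real k"
      using assms by (auto simp: min_def)
    then show ?thesis
      by (simp add: \<Phi>_def lessThan_Suc_atMost[symmetric] algebra_simps)
  qed
  then have "measure_pmf.expectation (trials p n) (\<lambda>X. p * (\<Sum>i\<le>n. of_bool (successes X i < k)))
      \<le> measure_pmf.expectation (trials p n) (\<lambda>X. \<Phi> n X + real k)"
    by (intro integral_mono) auto
  then show ?thesis
    by (simp add: martingale)
qed

subsection \<open>The free slots\<close>

text \<open>Otherwise all elements up to \<open>M\<close> would lie among the first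
  \<open>k\<close>, those with indices below \<open>k\<close>.\<close>

lemma enumerate_le_if_card_ge:
  fixes F :: "nat set"
  assumes "infinite F" and "k < card {x \<in> F. x \<le> M}"
  shows "enumerate F k \<le> M"
proof (rule ccontr)
  assume less: "\<not> enumerate F k \<le> M"
  have "{x \<in> F. x \<le> M} \<subseteq> enumerate F ` {..<k}"
  proof
    fix x assume x: "x \<in> {x \<in> F. x \<le> M}"
    then obtain n where n: "x = enumerate F n"
      using enumerate_Ex[OF assms(1), of x] by auto
    have "n < k"
      using x less n enumerate_mono_le_iff[OF assms(1), of k n] by auto
    then show "x \<in> enumerate F ` {..<k}"
      using n by simp
  qed
  then have "card {x \<in> F. x \<le> M} \<le> k"
    using surj_card_le[of "{..<k}"] by simp
  then show False
    using assms(2) by simp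
qed

text \<open>With \<open>c\<close> denoting the sum, at most \<open>c\<close> of the slots
  \<open>1, ..., k + c\<close> are occupied, so at least \<open>k\<close> are free.\<close>

lemma free_slot_le:
  assumes "finite A" and "\<And>J. J \<in> A \<Longrightarrow> 1 \<le> S J \<and> S J \<le> Suc n" and "1 \<le> k"
  shows "enumerate {m. 0 < m \<and> m \<notin> S_cs_int S X ` A} (k - 1)
    \<le> k + (\<Sum>i\<le>n. of_bool (successes X i < k))"
proof -
  define c where "c = (\<Sum>i\<le>n. of_bool (successes X i < k) :: nat)"
  define G where "G = S_cs_int S X ` A"
  define F where "F = {m. 0 < m \<and> m \<notin> G}"
  have c_card: "c = card {i \<in> {..n}. successes X i < k}"
    by (simp add: c_def sum_of_bool_eq Int_def)
  \<comment> \<open>By monotonicity the indices with fewer than \<open>k\<close> successes form an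
    initial segment of size \<open>c\<close>.\<close>
  have late: "k \<le> successes X i" if "c \<le> i" "i \<le> n" for i
  proof (rule ccontr)
    assume "\<not> k \<le> successes X i"
    then have "{..i} \<subseteq> {i \<in> {..n}. successes X i < k}"
      using that successes_mono[of _ i X] by fastforce
    from card_mono[OF _ this] show False
      using that c_card by simp
  qed
  have "G \<inter> {..k + c} \<subseteq> (\<lambda>s. s + successes X (s - 1)) ` {1..c}"
  proof
    fix x assume x: "x \<in> G \<inter> {..k + c}"
    then obtain J where J: "J \<in> A" "x = S J + successes X (S J - 1)"
      by (auto simp: G_def S_cs_int_def successes_def)
    \<comment> \<open>A later job is delayed by at least \<open>k\<close> successes and so lands
      beyond \<open>k + c\<close>.\<close>
    have "S J \<le> c"
      using late[of "S J - 1"] assms(2)[OF J(1)] J x by fastforce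
    then show "x \<in> (\<lambda>s. s + successes X (s - 1)) ` {1..c}"
      using J assms(2) by auto
  qed
  then have "card (G \<inter> {..k + c}) \<le> c"
    using surj_card_le[of "{1..c}"] by simp
  moreover have "{x \<in> F. x \<le> k + c} = {1..k + c} - (G \<inter> {..k + c})"
    by (auto simp: F_def)
  ultimately have "k \<le> card {x \<in> F. x \<le> k + c}"
    using diff_card_le_card_Diff[of "G \<inter> {..k + c}" "{1..k + c}"] by simp
  moreover have "infinite F"
  proof -
    have "F = {0<..} - G"
      by (auto simp: F_def)
    then show ?thesis
      using assms(1) by (simp add: G_def infinite_Ioi)
  qed
  ultimately show ?thesis
    using enumerate_le_if_card_ge[of F "k - 1" "k + c"] assms(3)
    by (simp add: F_def G_def c_def)
qed

subsection \<open>Outputs of the algorithms\<close>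

lemma finite_jobs: "finite (jobs I)"
  by (simp add: jobs_def)

lemma card_jobs: "card (jobs I) = num_jobs I"
  by (simp add: jobs_def num_jobs_def)

lemma schedules_list_range:
  assumes "schedules_list S Js" "J \<in> set Js"
  shows "1 \<le> S J \<and> S J \<le> length Js"
  using assms by (auto simp: schedules_list_def in_set_conv_nth)

lemma alg1_run_distinct: "alg1_run I Js \<Longrightarrow> distinct Js \<and> set Js \<subseteq> jobs I"
  by (induction rule: alg1_run.induct) (auto simp: available_jobs_def)

lemma alg1_output_range:
  assumes "alg1_output I S" "J \<in> jobs I"
  shows "1 \<le> S J"
proof -
  obtain Js where Js: "alg1_run I Js" "length Js = num_jobs I" "schedules_list S Js"
    using assms(1) by (auto simp: alg1_output_def)
  \<comment> \<open>A repetition-free list of \<open>num_jobs I\<close> jobs exhausts them.\<close>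
  have "set Js = jobs I"
    using alg1_run_distinct[OF Js(1)] Js(2)
    by (intro card_subset_eq) (auto simp: finite_jobs card_jobs distinct_card)
  then show ?thesis
    using schedules_list_range[OF Js(3)] assms(2) by blast
qed

text \<open>The upper bound keeps the trials entering \<open>S_cs_int\<close>, whose indices are
  below \<open>S J\<close>, within the sampled range.\<close>

lemma alg2_output_range:
  assumes "alg2_output I S" "J \<in> jobs I"
  shows "1 \<le> S J \<and> S J \<le> num_jobs I"
proof -
  obtain order where order: "distinct order" "set order = {1..num_chains I}"
    "schedules_list S (concat (map (\<lambda>i. map (Pair i) [1..<chain_len I i + 1]) order))"
    (is "schedules_list S ?Js")
    using assms(1) by (auto simp: alg2_output_def)
  have "length ?Js = sum_list (map (chain_len I) order)"
    by (simp add: length_concat comp_def del: upt_Suc)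
  also have "\<dots> = num_jobs I"
    using order by (simp add: num_jobs_def sum_list_distinct_conv_sum_set)
  finally have "length ?Js = num_jobs I" .
  moreover have "J \<in> set ?Js"
    using assms(2) order(2) by (auto simp: jobs_def image_iff simp del: upt_Suc)
  ultimately show ?thesis
    using schedules_list_range[OF order(3)] by metis
qed

section \<open>Expected completion times in the combined schedule\<close>

lemma S_wcs_le_pre:
  assumes "\<And>J. J \<in> jobs I \<Longrightarrow> 1 \<le> S_cs J"
  shows "S_wcs I S_wc S_cs X J \<le> S_wcs_pre I S_wc S_cs X J"
proof -
  let ?F = "{m. 0 < m \<and> m \<notin> S_cs_int S_cs X ` jobs I}"
  have "?F = {0<..} - S_cs_int S_cs X ` jobs I"
    by auto
  then have "infinite ?F"
    by (simp add: finite_jobs infinite_Ioi)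
  then have "0 < S_wc_int I S_wc S_cs X J'" for J'
    using enumerate_in_set[of ?F "S_wc J' - 1"] by (simp add: S_wc_int_def)
  moreover have "0 < S_cs_int S_cs X J'" if "J' \<in> jobs I" for J'
    using assms[OF that] by (simp add: S_cs_int_def)
  \<comment> \<open>All values are positive, so a rank among them cannot exceed the value
    ranked.\<close>
  ultimately have "{v \<in> S_wcs_pre I S_wc S_cs X ` jobs I. v \<le> S_wcs_pre I S_wc S_cs X J}
      \<subseteq> {1..S_wcs_pre I S_wc S_cs X J}"
    by (auto simp: S_wcs_pre_def Suc_le_eq)
  from card_mono[OF _ this] show ?thesis
    by (simp add: S_wcs_def)
qed

lemma expectation_S_wcs_le:
  assumes "0 < p" "p \<le> 1" and "alg1_output I S_wc" "alg2_output I S_cs" "J \<in> jobs I"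
  shows "measure_pmf.expectation (trials p (num_jobs I - 1)) (\<lambda>X. real (S_wcs I S_wc S_cs X J))
    \<le> (1 + 1 / p) * real (S_wc J)"
proof -
  let ?n = "num_jobs I - 1" and ?k = "S_wc J"
  let ?c = "\<lambda>X. \<Sum>i\<le>?n. of_bool (successes X i < ?k) :: real"
  note cs_range = alg2_output_range[OF assms(4)]
  have "real (S_wcs I S_wc S_cs X J) \<le> real ?k + ?c X" for X
  proof -
    have "S_wcs I S_wc S_cs X J \<le> S_wc_int I S_wc S_cs X J"
      using S_wcs_le_pre[of I S_cs S_wc X J] cs_range by (fastforce simp: S_wcs_pre_def)
    also have "\<dots> \<le> ?k + (\<Sum>i\<le>?n. of_bool (successes X i < ?k))"
      unfolding S_wc_int_def using cs_range alg1_output_range[OF assms(3,5)]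
      by (intro free_slot_le) (fastforce simp: finite_jobs)+
    finally have "real (S_wcs I S_wc S_cs X J)
        \<le> real (?k + (\<Sum>i\<le>?n. of_bool (successes X i < ?k)))"
      by (rule of_nat_mono)
    then show ?thesis
      by (simp del: sum_of_bool_eq)
  qed
  then have "measure_pmf.expectation (trials p ?n) (\<lambda>X. real (S_wcs I S_wc S_cs X J))
      \<le> measure_pmf.expectation (trials p ?n) (\<lambda>X. real ?k + ?c X)"
    by (intro integral_mono) auto
  also have "\<dots> = real ?k + measure_pmf.expectation (trials p ?n) ?c"
    by (subst Bochner_Integration.integral_add) auto
  also have "\<dots> \<le> real ?k + real ?k / p"
    using expectation_waiting_time[of p ?n ?k] assms(1,2) by (simp add: field_simps)
  finally show ?thesis
    by (simp add: algebra_simps)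
qed

lemma expectation_S_wcs_square_le:
  assumes "0 < p" "p \<le> 1" and "alg2_output I S_cs" "J \<in> jobs I"
  shows "measure_pmf.expectation (trials p (num_jobs I - 1))
      (\<lambda>X. (real (S_wcs I S_wc S_cs X J))\<^sup>2)
    \<le> (1 + 3 * p) * (real (S_cs J))\<^sup>2"
proof -
  let ?n = "num_jobs I - 1" and ?s = "S_cs J"
  let ?B = "\<lambda>X. real (successes X (?s - 1))"
  note cs_range = alg2_output_range[OF assms(3)]
  have "(real (S_wcs I S_wc S_cs X J))\<^sup>2 \<le> (real ?s)\<^sup>2 + 3 * real ?s * ?B X" for X
  proof -
    have B: "?B X \<le> real ?s"
      using successes_le[of X "?s - 1"] by linarith
    have "S_wcs I S_wc S_cs X J \<le> S_cs_int S_cs X J"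
      using S_wcs_le_pre[of I S_cs S_wc X J] cs_range by (fastforce simp: S_wcs_pre_def)
    also have "\<dots> = ?s + successes X (?s - 1)"
      by (simp add: S_cs_int_def successes_def)
    finally have "real (S_wcs I S_wc S_cs X J) \<le> real ?s + ?B X"
      by linarith
    then have "(real (S_wcs I S_wc S_cs X J))\<^sup>2 \<le> (real ?s + ?B X)\<^sup>2"
      by (intro power_mono) auto
    \<comment> \<open>The square term is at most \<open>?s * ?B X\<close>, which joins the cross
      term of coefficient 2.\<close>
    also have "\<dots> \<le> (real ?s)\<^sup>2 + 3 * real ?s * ?B X"
      using mult_right_mono[OF B, of "?B X"] by (simp add: power2_eq_square algebra_simps)
    finally show ?thesis .
  qed
  then have "measure_pmf.expectation (trials p ?n) (\<lambda>X. (real (S_wcs I S_wc S_cs X J))\<^sup>2)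
      \<le> measure_pmf.expectation (trials p ?n) (\<lambda>X. (real ?s)\<^sup>2 + 3 * real ?s * ?B X)"
    by (intro integral_mono) auto
  also have "\<dots> = (real ?s)\<^sup>2 + 3 * real ?s * (real (?s - 1) * p)"
    using cs_range[OF assms(4)] assms(1,2)
    by (subst Bochner_Integration.integral_add) (auto simp: expectation_successes)
  also have "\<dots> \<le> (real ?s)\<^sup>2 + 3 * real ?s * (real ?s * p)"
    using assms(1) by (intro add_left_mono mult_left_mono mult_right_mono) auto
  finally show ?thesis
    by (simp add: algebra_simps power2_eq_square)
qed

section \<open>The approximation ratio\<close>

theorem theorem2:
  fixes p :: real and I :: wcs_instance and S_wc S_cs :: schedule
  assumes "0 < p" and "p \<le> 1"
    and "valid_instance I"
    and "alg1_output I S_wc"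
    and "alg2_output I S_cs"
  shows "measure_pmf.expectation (alg3 p I S_wc S_cs) (wcs I) / (wc I S_wc + cs I S_cs)
           \<le> max (1 + 1 / p) (1 + 3 * p)"
proof -
  let ?M = "trials p (num_jobs I - 1)" and ?S = "S_wcs I S_wc S_cs"
  let ?r = "max (1 + 1 / p) (1 + 3 * p)"
  have leaf: "(i, chain_len I i) \<in> jobs I" if "i \<in> {1..num_chains I}" for i
    using that assms(3) by (auto simp: valid_instance_def jobs_def)
  have weight: "0 \<le> job_weight I i j" if "(i, j) \<in> jobs I" for i j
    using that assms(3) by (auto simp: valid_instance_def)
  have wc_nonneg: "0 \<le> wc I S_wc"
    unfolding wc_def by (intro sum_nonneg) (auto simp: weight)
  have cs_pos: "0 < cs I S_cs"
    unfolding cs_def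
  proof (rule sum_pos)
    show "{1..num_chains I} \<noteq> {}"
      using assms(3) by (simp add: valid_instance_def)
    show "0 < (real (S_cs (i, chain_len I i)))\<^sup>2" if "i \<in> {1..num_chains I}" for i
      using alg2_output_range[OF assms(5) leaf[OF that]] by simp
  qed simp
  \<comment> \<open>By linearity, weighted completion times are charged to \<open>S_wc\<close> job
    by job; the squared leaf times are charged to \<open>S_cs\<close> below.\<close>
  have "measure_pmf.expectation ?M (\<lambda>X. wc I (?S X)) =
      (\<Sum>(i, j)\<in>jobs I. job_weight I i j * measure_pmf.expectation ?M (\<lambda>X. real (?S X (i, j))))"
    by (simp add: wc_def case_prod_unfold)
  also have "\<dots> \<le> (\<Sum>(i, j)\<in>jobs I. job_weight I i j * ((1 + 1 / p) * real (S_wc (i, j))))"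
    using expectation_S_wcs_le[OF assms(1,2,4,5)] weight
    by (intro sum_mono) (auto intro!: mult_left_mono)
  also have "\<dots> = (1 + 1 / p) * wc I S_wc"
    by (simp add: wc_def sum_distrib_left case_prod_unfold mult_ac)
  also have "\<dots> \<le> ?r * wc I S_wc"
    using wc_nonneg by (intro mult_right_mono) auto
  finally have wc_bound: "measure_pmf.expectation ?M (\<lambda>X. wc I (?S X)) \<le> ?r * wc I S_wc" .
  have "measure_pmf.expectation ?M (\<lambda>X. cs I (?S X)) =
      (\<Sum>i=1..num_chains I.
        measure_pmf.expectation ?M (\<lambda>X. (real (?S X (i, chain_len I i)))\<^sup>2))"
    by (simp add: cs_def)
  also have "\<dots> \<le> (\<Sum>i=1..num_chains I. (1 + 3 * p) * (real (S_cs (i, chain_len I i)))\<^sup>2)"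
    using expectation_S_wcs_square_le[OF assms(1,2,5)] leaf by (intro sum_mono) blast
  also have "\<dots> = (1 + 3 * p) * cs I S_cs"
    by (simp add: cs_def sum_distrib_left)
  also have "\<dots> \<le> ?r * cs I S_cs"
    using cs_pos by (intro mult_right_mono) auto
  finally have cs_bound: "measure_pmf.expectation ?M (\<lambda>X. cs I (?S X)) \<le> ?r * cs I S_cs" .
  have "measure_pmf.expectation (alg3 p I S_wc S_cs) (wcs I) =
      measure_pmf.expectation ?M (\<lambda>X. wc I (?S X)) + measure_pmf.expectation ?M (\<lambda>X. cs I (?S X))"
    unfolding alg3_def trials_def[symmetric] by (simp add: wcs_def)
  also have "\<dots> \<le> ?r * (wc I S_wc + cs I S_cs)"
    using wc_bound cs_bound by (simp only: distrib_left add_mono)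
  finally show ?thesis
    using wc_nonneg cs_pos by (subst pos_divide_le_eq) auto
qed

end
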